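(* Let $m\in\mathbb{N}$ and $n=mp$, where $p$ is an odd prime. Then the circulant graph $\mathrm{Cay}(\mathbb{Z}_n,S)$ does not exhibit pretty good state transfer (between any pair of distinct vertices) if $p\nmid s$ for all $s\in S$.
   Context: All graphs are simple, undirected and finite; $\mathbb{N}$ is the set of positive integers. For a graph $G$ with adjacency matrix $A$, the transition matrix is $H(t)=\exp(-itA)$, $t\in\mathbb{R}$. Let $\mathbf{e}_u$ denote the characteristic vector of the vertex $u$. The graph $G$ exhibits pretty good state transfer between a pair of distinct vertices $u$ and $v$ if there is a sequence $\{t_j\}$ of real numbers such that $\lim_{j\to\infty}H(t_j)\mathbf{e}_u=\gamma\mathbf{e}_v$ for some $\gamma\in\mathbb{C}$ with $|\gamma|=1$. $\mathbb{Z}_n$ is the cyclic group of integers modulo $n$. For $S\subseteq\mathbb{Z}_n\setminus\{0\}$ with $\{-s:s\in S\}=S$, the circulant graph $\mathrm{Cay}(\mathbb{Z}_n,S)$ has vertex set $\mathbb{Z}_n$, with $a,b$ adjacent if and only if $a-b\in S$. Since $p\mid n$, the condition $p\nmid s$ for $s\in\mathbb{Z}_n$ does not depend on the integer representative of $s$. *)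

theory Defs
  imports Complex_Main "HOL-Computational_Algebra.Primes" "Jordan_Normal_Form.Matrix"
begin

text \<open>
  A graph on \<open>n\<close> vertices is given by its adjacency relation on the vertex set
  \<open>{0..<n}\<close>; values of the relation outside this set are irrelevant.
\<close>

definition adjacency_mat :: "nat \<Rightarrow> (nat \<Rightarrow> nat \<Rightarrow> bool) \<Rightarrow> complex mat" where
  "adjacency_mat n E = mat n n (\<lambda>(a, b). if E a b then 1 else 0)"

text \<open>
  The exponential series of a square matrix, summed entrywise (it always converges). The type
  of matrices is not a normed algebra, so the constant \<open>exp\<close> does not apply to it.
\<close>

definition mat_exp :: "complex mat \<Rightarrow> complex mat" where
  "mat_exp A = mat (dim_row A) (dim_row A) (\<lambda>(i, j). \<Sum>k. (A ^\<^sub>m k) $$ (i, j) / fact k)"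

definition transition_mat :: "nat \<Rightarrow> (nat \<Rightarrow> nat \<Rightarrow> bool) \<Rightarrow> real \<Rightarrow> complex mat" where
  "transition_mat n E t = mat_exp ((- \<i> * complex_of_real t) \<cdot>\<^sub>m adjacency_mat n E)"

text \<open>Convergence in \<open>\<complex>\<^sup>n\<close> is expressed coordinatewise.\<close>

definition pretty_good_state_transfer ::
    "nat \<Rightarrow> (nat \<Rightarrow> nat \<Rightarrow> bool) \<Rightarrow> nat \<Rightarrow> nat \<Rightarrow> bool" where
  "pretty_good_state_transfer n E u v \<longleftrightarrow>
     u < n \<and> v < n \<and> u \<noteq> v \<and>
     (\<exists>(t :: nat \<Rightarrow> real) \<gamma>. cmod \<gamma> = 1 \<and>
        (\<forall>i<n. (\<lambda>j. (transition_mat n E (t j) *\<^sub>v unit_vec n u) $ i)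
                 \<longlonglongrightarrow> (\<gamma> \<cdot>\<^sub>v unit_vec n v) $ i))"

text \<open>
  Residue classes modulo \<open>n\<close> are represented by \<open>0, \<dots>, n - 1\<close>: as integers
  for elements of connection sets, and as naturals for vertices, which index matrices.
\<close>

definition connection_set :: "nat \<Rightarrow> int set \<Rightarrow> bool" where
  "connection_set n S \<longleftrightarrow> S \<subseteq> {0..<int n} - {0} \<and> (\<lambda>s. (- s) mod int n) ` S = S"

definition circulant_graph :: "nat \<Rightarrow> int set \<Rightarrow> nat \<Rightarrow> nat \<Rightarrow> bool" where
  "circulant_graph n S a b \<longleftrightarrow> (int a - int b) mod int n \<in> S"

end

theory Submission
  imports Defs
begin

text \<open>
  Write \<open>\<chi>\<close> for the character \<open>x \<mapsto> exp (2\<pi>ix/n)\<close> of \<open>\<int>\<^sub>n\<close>, \<open>\<lambda>\<^sub>r\<close> for the eigenvalue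
  \<open>\<Sum>s\<in>S. \<chi>(rs)\<close> and \<open>d = v - u\<close>. Pairing the columns with the eigenvectors \<open>i \<mapsto> \<chi>(ri)\<close> shows
  that state transfer from \<open>u\<close> to \<open>v\<close> along \<open>t\<^sub>j\<close> forces \<open>exp(-it\<^sub>j\<lambda>\<^sub>r) \<longlonglongrightarrow> \<gamma>\<chi>(rd)\<close> for all \<open>r\<close>.
  As \<open>\<lambda>\<^sub>1 = \<lambda>\<^sub>-\<^sub>1\<close>, this gives \<open>\<chi>(2d) = 1\<close>. If \<open>p\<close> divides no element of \<open>S\<close>, then the
  eigenvalues \<open>\<lambda>\<^bsub>r+km\<^esub>\<close>, \<open>k < p\<close>, sum to zero, so the limits \<open>\<gamma>\<chi>((r+km)d)\<close> have product 1;
  comparing \<open>r = 1\<close> with \<open>r = 0\<close> gives \<open>\<chi>(pd) = 1\<close>. As \<open>p\<close> is odd, \<open>n\<close> divides \<open>d\<close>.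
\<close>

section \<open>Matrix powers, the exponential series and left eigenvectors\<close>

lemma pow_mat_entry_bound:
  fixes B :: "complex mat"
  assumes B: "B \<in> carrier_mat n n"
    and C: "\<And>i j. i < n \<Longrightarrow> j < n \<Longrightarrow> cmod (B $$ (i, j)) \<le> C"
    and "i < n" "j < n"
  shows "cmod ((B ^\<^sub>m k) $$ (i, j)) \<le> (real n * C) ^ k"
  using assms(3,4)
proof (induction k arbitrary: i j)
  case 0
  then show ?case using B by (auto simp: one_mat_def)
next
  case (Suc k)
  have C0: "0 \<le> C" using C[OF Suc.prems] norm_ge_zero order_trans by blast
  have P: "B ^\<^sub>m k \<in> carrier_mat n n" using B by simp
  have "(B ^\<^sub>m Suc k) $$ (i, j) = (\<Sum>q<n. (B ^\<^sub>m k) $$ (i, q) * B $$ (q, j))"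
    using B P Suc.prems by (simp add: scalar_prod_def lessThan_atLeast0)
  also have "cmod \<dots> \<le> (\<Sum>q<n. (real n * C) ^ k * C)"
    using Suc C C0 by (intro sum_norm_le) (auto simp: norm_mult intro!: mult_mono)
  finally show ?case by (simp add: algebra_simps)
qed

text \<open>The series is dominated by the exponential series of \<open>real n * C\<close>.
  Convergence is what later permits exchanging it with finite sums.\<close>

lemma summable_mat_exp_entry:
  fixes B :: "complex mat"
  assumes B: "B \<in> carrier_mat n n" and "i < n" "j < n"
  shows "summable (\<lambda>k. (B ^\<^sub>m k) $$ (i, j) / fact k)"
proof -
  \<comment> \<open>The sum of all moduli bounds every entry and, unlike a maximum, makes sense
    without entries.\<close>
  define C where "C = (\<Sum>i<n. \<Sum>j<n. cmod (B $$ (i, j)))"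
  have C: "cmod (B $$ (a, b)) \<le> C" if "a < n" "b < n" for a b
  proof -
    have "cmod (B $$ (a, b)) \<le> (\<Sum>j<n. cmod (B $$ (a, j)))"
      using that by (intro member_le_sum) auto
    also have "\<dots> \<le> C" unfolding C_def
      using that by (intro member_le_sum[of a _ "\<lambda>i. \<Sum>j<n. cmod (B $$ (i, j))"])
        (auto intro: sum_nonneg)
    finally show ?thesis .
  qed
  show ?thesis
  proof (rule summable_comparison_test')
    show "summable (\<lambda>k. inverse (fact k) * (real n * C) ^ k)"
      by (rule summable_exp)
    show "norm ((B ^\<^sub>m k) $$ (i, j) / fact k) \<le> inverse (fact k) * (real n * C) ^ k" for k
      using pow_mat_entry_bound[OF B C assms(2,3), of k]
      by (simp add: norm_divide divide_simps)
  qed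
qed

text \<open>Peel off the last factor: the row vector \<open>w\<close> meets
  \<open>B ^\<^sub>m k\<close> first, then \<open>B\<close>. Left eigenvectors are used because they
  pair with columns, and the evolved state is a column.\<close>

lemma left_eigenvector_pow:
  fixes B :: "complex mat"
  assumes B: "B \<in> carrier_mat n n"
    and eig: "\<And>l. l < n \<Longrightarrow> (\<Sum>i<n. w i * B $$ (i, l)) = \<mu> * w l"
    and "l < n"
  shows "(\<Sum>i<n. w i * (B ^\<^sub>m k) $$ (i, l)) = \<mu> ^ k * w l"
  using assms(3)
proof (induction k arbitrary: l)
  case 0
  have "(\<Sum>i<n. w i * (B ^\<^sub>m 0) $$ (i, l)) = (\<Sum>i<n. if i = l then w i else 0)"
    using B 0 by (intro sum.cong) (auto simp: one_mat_def)
  then show ?case using 0 by simp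
next
  case (Suc k)
  have P: "B ^\<^sub>m k \<in> carrier_mat n n" using B by simp
  have "(\<Sum>i<n. w i * (B ^\<^sub>m Suc k) $$ (i, l))
      = (\<Sum>i<n. \<Sum>q<n. w i * (B ^\<^sub>m k) $$ (i, q) * B $$ (q, l))"
    using B P Suc.prems
    by (simp add: scalar_prod_def lessThan_atLeast0 sum_distrib_left mult.assoc)
  also have "\<dots> = (\<Sum>q<n. (\<Sum>i<n. w i * (B ^\<^sub>m k) $$ (i, q)) * B $$ (q, l))"
    by (subst sum.swap) (simp add: sum_distrib_right)
  also have "\<dots> = \<mu> ^ k * (\<Sum>q<n. w q * B $$ (q, l))"
    using Suc.IH by (simp add: sum_distrib_left mult.assoc)
  finally show ?case using eig[OF Suc.prems] by simp
qed

text \<open>Apply the identity for powers to each term of the series; no diagonalisation of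
  \<open>B\<close> is required.\<close>

lemma left_eigenvector_mat_exp:
  fixes B :: "complex mat"
  assumes B: "B \<in> carrier_mat n n"
    and eig: "\<And>l. l < n \<Longrightarrow> (\<Sum>i<n. w i * B $$ (i, l)) = \<mu> * w l"
    and l: "l < n"
  shows "(\<Sum>i<n. w i * mat_exp B $$ (i, l)) = exp \<mu> * w l"
proof -
  have sm: "summable (\<lambda>k. w i * ((B ^\<^sub>m k) $$ (i, l) / fact k))" if "i < n" for i
    using summable_mat_exp_entry[OF B that l] by (rule summable_mult)
  have "(\<Sum>i<n. w i * mat_exp B $$ (i, l))
      = (\<Sum>i<n. \<Sum>k. w i * ((B ^\<^sub>m k) $$ (i, l) / fact k))"
    using B l suminf_mult[OF summable_mat_exp_entry[OF B _ l]]
    by (intro sum.cong refl) (simp add: mat_exp_def)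
  also have "\<dots> = (\<Sum>k. \<Sum>i<n. w i * ((B ^\<^sub>m k) $$ (i, l) / fact k))"
    using sm by (intro suminf_sum[symmetric]) auto
  also have "\<dots> = (\<Sum>k. w l * (\<mu> ^ k /\<^sub>R fact k))"
    using left_eigenvector_pow[OF B eig l]
    by (intro suminf_cong) (simp add: sum_divide_distrib[symmetric] scaleR_conv_of_real field_simps)
  also have "\<dots> = w l * exp \<mu>"
    unfolding exp_def by (intro suminf_mult summable_exp_generic)
  finally show ?thesis by (simp add: mult.commute)
qed

section \<open>Characters of the cyclic group\<close>

definition cyc_char :: "nat \<Rightarrow> int \<Rightarrow> complex" where
  "cyc_char n x = cis (2 * pi * of_int x / of_nat n)"

lemma cyc_char_add: "cyc_char n (x + y) = cyc_char n x * cyc_char n y"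
  by (simp add: cyc_char_def cis_mult ring_distribs add_divide_distrib)

lemma cyc_char_0 [simp]: "cyc_char n 0 = 1"
  by (simp add: cyc_char_def)

lemma cyc_char_nonzero [simp]: "cyc_char n x \<noteq> 0"
  by (simp add: cyc_char_def)

lemma cyc_char_of_nat_mult: "cyc_char n (int k * x) = cyc_char n x ^ k"
  by (induction k) (simp_all add: ring_distribs cyc_char_add)

text \<open>This turns identities between phases into divisibility. Positivity matters: for
  \<open>n = 0\<close> division by zero makes the character constantly 1.\<close>

lemma cyc_char_eq_1_iff:
  assumes "n > 0"
  shows "cyc_char n x = 1 \<longleftrightarrow> int n dvd x"
proof
  assume "cyc_char n x = 1"
  \<comment> \<open>The real part alone determines the angle modulo \<open>2 * pi\<close>
    here.\<close>
  then have "cos (2 * pi * of_int x / of_nat n) = 1"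
    by (simp add: cyc_char_def complex_eq_iff)
  then obtain k :: int where "2 * pi * of_int x / of_nat n = of_int k * 2 * pi"
    using cos_one_2pi_int by blast
  then have "real_of_int x = real_of_int (int n * k)"
    using assms by (simp add: field_simps)
  then show "int n dvd x"
    unfolding of_int_eq_iff by simp
next
  assume "int n dvd x"
  then obtain k where "x = int n * k" ..
  then have "2 * pi * of_int x / of_nat n = 2 * pi * of_int k"
    using assms by simp
  then show "cyc_char n x = 1"
    unfolding cyc_char_def by (metis cis_multiple_2pi Ints_of_int)
qed

lemma cyc_char_cong:
  assumes "n > 0" "int n dvd x - y"
  shows "cyc_char n x = cyc_char n y"
  using cyc_char_add[of n "x - y" y] cyc_char_eq_1_iff[OF assms(1)] assms(2) by simp

section \<open>Eigenvalues and eigenvectors of circulant graphs\<close>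

definition circ_eigenvalue :: "nat \<Rightarrow> int set \<Rightarrow> int \<Rightarrow> complex" where
  "circ_eigenvalue n S r = (\<Sum>s\<in>S. cyc_char n (r * s))"

text \<open>Negation modulo \<open>n\<close> permutes \<open>S\<close>, so the sum can be reindexed
  by it.\<close>

lemma circ_eigenvalue_minus:
  assumes "n > 0" "connection_set n S"
  shows "circ_eigenvalue n S (- r) = circ_eigenvalue n S r"
proof -
  have img: "(\<lambda>s. (- s) mod int n) ` S = S" and sub: "S \<subseteq> {0..<int n} - {0}"
    using assms(2) by (auto simp: connection_set_def)
  have "finite S" using sub finite_subset by blast
  \<comment> \<open>A map from a finite set onto itself is injective.\<close>
  then have inj: "inj_on (\<lambda>s. (- s) mod int n) S"
    using img by (simp add: eq_card_imp_inj_on)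
  have "circ_eigenvalue n S r = (\<Sum>s\<in>S. cyc_char n (r * ((- s) mod int n)))"
    unfolding circ_eigenvalue_def by (subst (1) img[symmetric]) (simp add: sum.reindex[OF inj])
  also have "\<dots> = (\<Sum>s\<in>S. cyc_char n (- r * s))"
  proof (intro sum.cong refl cyc_char_cong[OF assms(1)])
    fix s
    have "r * ((- s) mod int n) - - r * s = r * ((- s) mod int n - (- s))"
      by (simp add: algebra_simps)
    moreover have "int n dvd (- s) mod int n - (- s)"
      by (metis mod_eq_dvd_iff mod_mod_trivial)
    ultimately show "int n dvd r * ((- s) mod int n) - - r * s" by simp
  qed
  finally show ?thesis by (simp add: circ_eigenvalue_def)
qed

text \<open>The neighbours of \<open>l\<close> are the residues \<open>l + s\<close> with
  \<open>s \<in> S\<close>; after this substitution the factor \<open>cyc_char n (r * int l)\<close>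
  comes out of the sum.\<close>

lemma circulant_left_eigenvector:
  assumes "connection_set n S" and l: "l < n"
  shows "(\<Sum>i<n. cyc_char n (r * int i) * adjacency_mat n (circulant_graph n S) $$ (i, l))
    = circ_eigenvalue n S r * cyc_char n (r * int l)"
proof -
  have n: "n > 0" using l by simp
  have S: "S \<subseteq> {0..<int n}" using assms(1) by (auto simp: connection_set_def)
  define N where "N = {i. i < n \<and> (int i - int l) mod int n \<in> S}"
  have "(\<Sum>i<n. cyc_char n (r * int i) * adjacency_mat n (circulant_graph n S) $$ (i, l))
      = (\<Sum>i<n. if (int i - int l) mod int n \<in> S then cyc_char n (r * int i) else 0)"
    using l by (intro sum.cong) (auto simp: adjacency_mat_def circulant_graph_def)
  also have "\<dots> = (\<Sum>i\<in>N. cyc_char n (r * int i))"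
    by (simp add: sum.If_cases N_def lessThan_def Collect_conj_eq Int_commute)
  also have "\<dots> = (\<Sum>s\<in>S. cyc_char n (r * (int l + s)))"
  proof (rule sum.reindex_bij_witness[where i = "\<lambda>s. nat ((int l + s) mod int n)"
        and j = "\<lambda>i. (int i - int l) mod int n"])
    fix i assume i: "i \<in> N"
    then show "nat ((int l + (int i - int l) mod int n) mod int n) = i"
      by (simp add: N_def mod_add_right_eq)
    show "(int i - int l) mod int n \<in> S" using i by (simp add: N_def)
    have "int n dvd (int l + (int i - int l) mod int n) - int i"
      by (simp add: mod_eq_dvd_iff[symmetric] mod_add_right_eq)
    then have "int n dvd r * ((int l + (int i - int l) mod int n) - int i)" by simp
    then show "cyc_char n (r * (int l + (int i - int l) mod int n)) = cyc_char n (r * int i)"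
      by (intro cyc_char_cong[OF n]) (simp only: right_diff_distrib)
  next
    fix s assume s: "s \<in> S"
    then have "s mod int n = s" using S by auto
    then show *: "(int (nat ((int l + s) mod int n)) - int l) mod int n = s"
      using n by (simp add: mod_diff_left_eq)
    then show "nat ((int l + s) mod int n) \<in> N"
      using s n by (simp add: N_def nat_less_iff)
  qed
  also have "\<dots> = circ_eigenvalue n S r * cyc_char n (r * int l)"
    by (simp add: circ_eigenvalue_def ring_distribs cyc_char_add sum_distrib_left mult.commute)
  finally show ?thesis .
qed

section \<open>Phase limits, coset sums of eigenvalues and the divisibility argument\<close>

lemma transition_mat_character:
  assumes "connection_set n S" "u < n"
  shows "(\<Sum>i<n. cyc_char n (r * int i) *
      (transition_mat n (circulant_graph n S) t *\<^sub>v unit_vec n u) $ i)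
    = exp (- \<i> * complex_of_real t * circ_eigenvalue n S r) * cyc_char n (r * int u)"
proof -
  let ?A = "adjacency_mat n (circulant_graph n S)"
  let ?B = "(- \<i> * complex_of_real t) \<cdot>\<^sub>m ?A"
  have A: "?A \<in> carrier_mat n n" by (simp add: adjacency_mat_def)
  then have B: "?B \<in> carrier_mat n n" by simp
  have "(\<Sum>i<n. cyc_char n (r * int i) * ?B $$ (i, l))
      = (- \<i> * complex_of_real t * circ_eigenvalue n S r) * cyc_char n (r * int l)"
    if "l < n" for l
  proof -
    have "(\<Sum>i<n. cyc_char n (r * int i) * ?B $$ (i, l))
        = (- \<i> * complex_of_real t) * (\<Sum>i<n. cyc_char n (r * int i) * ?A $$ (i, l))"
      using A that by (simp add: sum_distrib_left algebra_simps)
    then show ?thesis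
      by (simp add: circulant_left_eigenvector[OF assms(1) that])
  qed
  from left_eigenvector_mat_exp[OF B this assms(2)]
  have "(\<Sum>i<n. cyc_char n (r * int i) * mat_exp ?B $$ (i, u))
    = exp (- \<i> * complex_of_real t * circ_eigenvalue n S r) * cyc_char n (r * int u)" .
  moreover have "(transition_mat n (circulant_graph n S) t *\<^sub>v unit_vec n u) $ i
      = mat_exp ?B $$ (i, u)" if "i < n" for i
  proof -
    have "mat_exp ?B \<in> carrier_mat n n"
      using carrier_matD[OF A] by (simp add: mat_exp_def)
    then show ?thesis
      using that assms(2) by (simp add: transition_mat_def scalar_prod_right_unit)
  qed
  ultimately show ?thesis by simp
qed

lemma state_transfer_phase_limit:
  assumes "connection_set n S" "u < n" "v < n"
    and lim: "\<forall>i<n. (\<lambda>j. (transition_mat n (circulant_graph n S) (t j) *\<^sub>v unit_vec n u) $ i)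
                 \<longlonglongrightarrow> (\<gamma> \<cdot>\<^sub>v unit_vec n v) $ i"
  shows "(\<lambda>j. exp (- \<i> * complex_of_real (t j) * circ_eigenvalue n S r))
    \<longlonglongrightarrow> \<gamma> * cyc_char n (r * (int v - int u))"
proof -
  have "(\<lambda>j. \<Sum>i<n. cyc_char n (r * int i) *
        (transition_mat n (circulant_graph n S) (t j) *\<^sub>v unit_vec n u) $ i)
      \<longlonglongrightarrow> (\<Sum>i<n. cyc_char n (r * int i) * (\<gamma> \<cdot>\<^sub>v unit_vec n v) $ i)"
    using lim by (intro tendsto_sum tendsto_mult_left) auto
  also have "(\<Sum>i<n. cyc_char n (r * int i) * (\<gamma> \<cdot>\<^sub>v unit_vec n v) $ i)
      = (\<Sum>i<n. if i = v then \<gamma> * cyc_char n (r * int v) else 0)"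
    using assms(3) by (intro sum.cong) (auto simp: unit_vec_def)
  also have "\<dots> = \<gamma> * cyc_char n (r * int v)" using assms(3) by simp
  \<comment> \<open>Split off the nonzero factor that also occurs in the sequence, so that division
    removes it from both sides.\<close>
  also have "\<dots> = \<gamma> * cyc_char n (r * (int v - int u)) * cyc_char n (r * int u)"
    by (simp add: cyc_char_add[symmetric] algebra_simps)
  finally have "(\<lambda>j. exp (- \<i> * complex_of_real (t j) * circ_eigenvalue n S r) * cyc_char n (r * int u))
      \<longlonglongrightarrow> \<gamma> * cyc_char n (r * (int v - int u)) * cyc_char n (r * int u)"
    unfolding transition_mat_character[OF assms(1,2)] .
  from tendsto_divide[OF this tendsto_const[of "cyc_char n (r * int u)"]]
  show ?thesis by simp
qed

text \<open>After swapping the sums, each \<open>s\<close> contributes a geometric sum in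
  \<open>cyc_char n (int m * s)\<close>. This is a \<open>p\<close>-th root of unity since
  \<open>n = m * p\<close>, and it is not 1 because \<open>n\<close> dividing \<open>m * s\<close>
  would force \<open>p\<close> to divide \<open>s\<close>.\<close>

lemma sum_circ_eigenvalue_coset:
  assumes "n > 0" "n = m * p" and ndvd: "\<forall>s\<in>S. \<not> int p dvd s"
  shows "(\<Sum>k<p. circ_eigenvalue n S (r + int k * int m)) = 0"
proof -
  have "(\<Sum>k<p. circ_eigenvalue n S (r + int k * int m))
      = (\<Sum>s\<in>S. \<Sum>k<p. cyc_char n (r * s) * cyc_char n (int m * s) ^ k)"
    unfolding circ_eigenvalue_def
    by (subst sum.swap)
      (simp add: cyc_char_of_nat_mult[symmetric] cyc_char_add[symmetric] algebra_simps)
  also have "\<dots> = (\<Sum>s\<in>S. 0)"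
  proof (intro sum.cong refl)
    fix s assume s: "s \<in> S"
    let ?z = "cyc_char n (int m * s)"
    have "?z \<noteq> 1"
      using ndvd s assms(1,2) by (simp add: cyc_char_eq_1_iff)
    moreover have "?z ^ p = 1"
      using assms(1,2)
      by (simp add: cyc_char_of_nat_mult[symmetric] cyc_char_eq_1_iff mult.left_commute)
    ultimately show "(\<Sum>k<p. cyc_char n (r * s) * ?z ^ k) = 0"
      by (simp add: sum_distrib_left[symmetric] geometric_sum)
  qed
  finally show ?thesis by simp
qed

theorem theorem2p6:
  fixes m n p :: nat and S :: "int set"
  assumes "m \<ge> 1"
    and "prime p" and "odd p"
    and "n = m * p"
    and "connection_set n S"
    and "\<forall>s\<in>S. \<not> int p dvd s"
  shows "\<not> (\<exists>u v. pretty_good_state_transfer n (circulant_graph n S) u v)"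
proof
  assume "\<exists>u v. pretty_good_state_transfer n (circulant_graph n S) u v"
  then obtain u v t \<gamma> where uv: "u < n" "v < n" "u \<noteq> v" and "cmod \<gamma> = 1"
    and lim: "\<forall>i<n. (\<lambda>j. (transition_mat n (circulant_graph n S) (t j) *\<^sub>v unit_vec n u) $ i)
                 \<longlonglongrightarrow> (\<gamma> \<cdot>\<^sub>v unit_vec n v) $ i"
    unfolding pretty_good_state_transfer_def by blast
  have n: "n > 0" and \<gamma>: "\<gamma> \<noteq> 0" using uv \<open>cmod \<gamma> = 1\<close> by auto
  define d where "d = int v - int u"
  define \<phi> where "\<phi> r j = exp (- \<i> * complex_of_real (t j) * circ_eigenvalue n S r)" for r j
  have phase: "\<phi> r \<longlonglongrightarrow> \<gamma> * cyc_char n (r * d)" for r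
    unfolding \<phi>_def d_def by (rule state_transfer_phase_limit[OF assms(5) uv(1,2) lim])

  have "\<phi> (- 1) = \<phi> 1"
    by (simp add: \<phi>_def circ_eigenvalue_minus[OF n assms(5)] fun_eq_iff)
  then have "\<gamma> * cyc_char n d = \<gamma> * cyc_char n (- d)"
    using LIMSEQ_unique[OF phase[of 1]] phase[of "- 1"] by simp
  \<comment> \<open>Cancel \<open>\<gamma>\<close> and multiply by \<open>cyc_char n d\<close>; the
    right side is then 1.\<close>
  then have "cyc_char n (d + d) = cyc_char n (- d + d)"
    using \<gamma> unfolding cyc_char_add by simp
  then have 2: "int n dvd 2 * d"
    using cyc_char_eq_1_iff[OF n, of "d + d"] by simp

  have prod1: "(\<Prod>k<p. \<gamma> * cyc_char n ((r + int k * int m) * d)) = 1" for r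
  proof (rule LIMSEQ_unique)
    show "(\<lambda>j. \<Prod>k<p. \<phi> (r + int k * int m) j) \<longlonglongrightarrow> (\<Prod>k<p. \<gamma> * cyc_char n ((r + int k * int m) * d))"
      by (intro tendsto_prod phase)
    \<comment> \<open>The product is the exponential of a multiple of the vanishing coset sum, hence
      1 at every time, not only in the limit.\<close>
    have "(\<Prod>k<p. \<phi> (r + int k * int m) j) = 1" for j
      using sum_circ_eigenvalue_coset[OF n assms(4,6), of r]
      by (simp add: \<phi>_def exp_sum[symmetric] sum_distrib_left[symmetric] sum_negf)
    then show "(\<lambda>j. \<Prod>k<p. \<phi> (r + int k * int m) j) \<longlonglongrightarrow> 1" by simp
  qed
  \<comment> \<open>Passing from \<open>r = 0\<close> to \<open>r = 1\<close> multiplies each of the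
    \<open>p\<close> factors by \<open>cyc_char n d\<close>. The summand 0 is kept so that
    \<open>prod1\<close> matches both products.\<close>
  have "(\<Prod>k<p. \<gamma> * cyc_char n ((1 + int k * int m) * d))
      = (\<Prod>k<p. cyc_char n d * (\<gamma> * cyc_char n ((0 + int k * int m) * d)))"
    by (intro prod.cong) (simp_all add: ring_distribs cyc_char_add)
  also have "\<dots> = cyc_char n d ^ p * (\<Prod>k<p. \<gamma> * cyc_char n ((0 + int k * int m) * d))"
    by (subst prod.distrib) simp
  finally have "cyc_char n (int p * d) = 1"
    unfolding prod1 cyc_char_of_nat_mult by simp
  then have p: "int n dvd int p * d"
    by (simp add: cyc_char_eq_1_iff[OF n])

  \<comment> \<open>An explicit Bezout relation between \<open>p\<close> and 2 combines the two
    divisibilities.\<close>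
  from \<open>odd p\<close> obtain q where "p = 2 * q + 1" by (auto elim: oddE)
  then have "d = int p * d - int q * (2 * d)" by (simp add: algebra_simps)
  with 2 p have "int n dvd d" by (metis dvd_diff dvd_mult)
  \<comment> \<open>Distinct vertices in \<open>{0..<n}\<close> cannot differ by a multiple of
    \<open>n\<close>.\<close>
  moreover have "\<bar>d\<bar> < int n" and "d \<noteq> 0" using uv by (auto simp: d_def)
  ultimately show False using zdvd_not_zless[of "\<bar>d\<bar>" "int n"] by simp
qed

end
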